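(* For every integer $k$ with $1\leq k\leq 150$, $$\genfrac{[}{]}{0pt}{}{1/2+k}{k}_q \;\geq_q\; \genfrac{[}{]}{0pt}{}{1/4+k}{k}_q .$$
   Context: Let $\mathcal P=\bigcup_{b\ge 1}\mathbb{Q}[[q^{1/b}]]$ be the ring of Puiseux series over $\mathbb{Q}$ with nonnegative exponents (formal series in $q$ whose exponents are nonnegative rationals admitting a common denominator). For $A(q)=\sum_{\alpha\in\mathbb{Q}_{\ge 0}}a_\alpha q^\alpha\in\mathcal P$, the integer trace is $\operatorname{Tr}_{\mathbb Z}A(q):=\sum_{d\in\mathbb{Z}_{\ge 0}}a_d q^d\in\mathbb{Q}[[q]]$, i.e. all terms with nonintegral exponent are discarded. For $F,G\in\mathcal P$, write $F\geq_q G$ if and only if every coefficient of $\operatorname{Tr}_{\mathbb Z}(F-G)$ is nonnegative. For an integer $k\ge 0$ and a positive rational $r$, the generalized Gaussian binomial coefficient is the element of $\mathcal P$ $$\genfrac{[}{]}{0pt}{}{r+k}{k}_q=\frac{(1-q^{r+1})(1-q^{r+2})\cdots(1-q^{r+k})}{(1-q)(1-q^2)\cdots(1-q^k)}.$$ *)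

theory Defs
  imports Complex_Main "HOL-Computational_Algebra.Formal_Power_Series"
begin

text \<open>
  A Puiseux series over the rationals with nonnegative exponents is represented by its coefficient
  function: the coefficient of \<open>q\<^sup>a\<close> is the value at \<open>a :: rat\<close>. The support lies in
  \<open>(1/b)\<int>\<^sub>\<ge>\<^sub>0\<close> for some \<open>b \<ge> 1\<close>, so that the type is the union of the rings \<open>\<rat>[[q\<^sup>1\<^sup>/\<^sup>b]]\<close>.
\<close>

definition puiseux_support :: "nat \<Rightarrow> rat set" where
  "puiseux_support b = {of_nat n / of_nat b | n. True}"

typedef puiseux = "{f :: rat \<Rightarrow> rat. \<exists>b\<ge>1. \<forall>a. f a \<noteq> 0 \<longrightarrow> a \<in> puiseux_support b}"
  morphisms pcoeff Abs_puiseux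
  by (rule exI[of _ "\<lambda>_. 0"]) auto

setup_lifting type_definition_puiseux

lemma puiseux_eqI: "(\<And>a. pcoeff F a = pcoeff G a) \<Longrightarrow> F = G"
  by (simp add: pcoeff_inject[symmetric] fun_eq_iff)

text \<open>Substitution of \<open>q\<^sup>1\<^sup>/\<^sup>b\<close> for the variable of an ordinary power series.\<close>

definition subst_root_coeff :: "nat \<Rightarrow> rat fps \<Rightarrow> rat \<Rightarrow> rat" where
  "subst_root_coeff b f a =
     (if a \<in> puiseux_support b then fps_nth f (nat \<lfloor>a * of_nat b\<rfloor>) else 0)"

lemma subst_root_coeff_of_nat [simp]:
  "b \<ge> 1 \<Longrightarrow> subst_root_coeff b f (of_nat n / of_nat b) = fps_nth f n"
  by (auto simp: subst_root_coeff_def puiseux_support_def)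

lemma subst_root_coeff_outside:
  "a \<notin> puiseux_support b \<Longrightarrow> subst_root_coeff b f a = 0"
  by (simp add: subst_root_coeff_def)

lemma puiseux_support_mono:
  assumes "c \<ge> 1"
  shows "puiseux_support b \<subseteq> puiseux_support (b * c)"
proof
  fix a assume "a \<in> puiseux_support b"
  then obtain n where "a = of_nat n / of_nat b" by (auto simp: puiseux_support_def)
  then have "a = of_nat (n * c) / of_nat (b * c)" using assms by simp
  then show "a \<in> puiseux_support (b * c)" unfolding puiseux_support_def by blast
qed

lemma eq_subst_root_coeff:
  assumes "b \<ge> 1" "\<forall>a. f a \<noteq> 0 \<longrightarrow> a \<in> puiseux_support b"
  shows "f = subst_root_coeff b (Abs_fps (\<lambda>n. f (of_nat n / of_nat b)))"
proof
  fix a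
  show "f a = subst_root_coeff b (Abs_fps (\<lambda>n. f (of_nat n / of_nat b))) a"
  proof (cases "a \<in> puiseux_support b")
    case True
    then obtain n where "a = of_nat n / of_nat b" by (auto simp: puiseux_support_def)
    then show ?thesis using assms by simp
  next
    case False
    then show ?thesis using assms by (auto simp: subst_root_coeff_def)
  qed
qed

definition conv :: "(rat \<Rightarrow> rat) \<Rightarrow> (rat \<Rightarrow> rat) \<Rightarrow> rat \<Rightarrow> rat" where
  "conv f g a = (\<Sum>s | f s \<noteq> 0 \<and> g (a - s) \<noteq> 0. f s * g (a - s))"

lemma conv_subst_root_coeff:
  assumes "b \<ge> 1"
  shows "conv (subst_root_coeff b f) (subst_root_coeff b g) = subst_root_coeff b (f * g)"
proof
  fix a
  let ?f = "subst_root_coeff b f" and ?g = "subst_root_coeff b g"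
  let ?S = "{s. ?f s \<noteq> 0 \<and> ?g (a - s) \<noteq> 0}"
  have b: "(of_nat b :: rat) \<noteq> 0" using assms by simp
  show "conv ?f ?g a = subst_root_coeff b (f * g) a"
  proof (cases "a \<in> puiseux_support b")
    case True
    then obtain n where a: "a = of_nat n / of_nat b" by (auto simp: puiseux_support_def)
    let ?h = "\<lambda>i::nat. of_nat i / of_nat b :: rat"
    have sub: "?S \<subseteq> ?h ` {0..n}"
    proof
      fix s assume "s \<in> ?S"
      then have "s \<in> puiseux_support b" "a - s \<in> puiseux_support b"
        using subst_root_coeff_outside by blast+
      then obtain i j where s: "s = ?h i" and as: "a - s = ?h j"
        by (auto simp: puiseux_support_def)
      have "of_nat n / of_nat b = (of_nat (i + j) / of_nat b :: rat)"
        using a s as by (simp add: add_divide_distrib algebra_simps)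
      then have "of_nat n = (of_nat (i + j) :: rat)" using b by (metis divide_cancel_right)
      then have "n = i + j" using of_nat_eq_iff by blast
      then have "i \<in> {0..n}" by simp
      then show "s \<in> ?h ` {0..n}" using s by (rule rev_image_eqI)
    qed
    have "conv ?f ?g a = (\<Sum>s\<in>?h ` {0..n}. ?f s * ?g (a - s))"
      unfolding conv_def by (rule sum.mono_neutral_left) (use sub in auto)
    also have "\<dots> = (\<Sum>i\<in>{0..n}. ?f (?h i) * ?g (a - ?h i))"
      by (subst sum.reindex) (use b in \<open>auto simp: inj_on_def\<close>)
    also have "\<dots> = (\<Sum>i\<in>{0..n}. fps_nth f i * fps_nth g (n - i))"
    proof (rule sum.cong)
      fix i assume "i \<in> {0..n}"
      then have "a - ?h i = ?h (n - i)" by (simp add: a of_nat_diff diff_divide_distrib)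
      then show "?f (?h i) * ?g (a - ?h i) = fps_nth f i * fps_nth g (n - i)"
        using assms by simp
    qed simp
    also have "\<dots> = subst_root_coeff b (f * g) a" using assms by (simp add: a fps_mult_nth)
    finally show ?thesis .
  next
    case False
    have "?S = {}"
    proof (rule ccontr)
      assume "?S \<noteq> {}"
      then obtain s where "s \<in> ?S" by blast
      then have "s \<in> puiseux_support b" "a - s \<in> puiseux_support b"
        using subst_root_coeff_outside by blast+
      then obtain i j where "s = of_nat i / of_nat b" "a - s = of_nat j / of_nat b"
        by (auto simp: puiseux_support_def)
      then have "a = of_nat (i + j) / of_nat b" by (simp add: add_divide_distrib algebra_simps)
      then show False using False unfolding puiseux_support_def by blast
    qed
    then have "conv ?f ?g a = 0" unfolding conv_def by (simp only: sum.empty)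
    then show ?thesis using False by (simp add: subst_root_coeff_outside)
  qed
qed

lift_definition subst_root :: "nat \<Rightarrow> rat fps \<Rightarrow> puiseux" is
  "\<lambda>b f. if b \<ge> 1 then subst_root_coeff b f else (\<lambda>_. 0)"
  using subst_root_coeff_outside by (auto split: if_splits)

text \<open>The monomial \<open>q\<^sup>a\<close>; for \<open>a < 0\<close>, where \<open>q\<^sup>a\<close> is not in the ring, the value is the dummy 0.\<close>

lift_definition qpow :: "rat \<Rightarrow> puiseux" is "\<lambda>a c. if a \<ge> 0 \<and> c = a then 1 else 0"
proof -
  fix a :: rat
  show "\<exists>b\<ge>1. \<forall>c. (if a \<ge> 0 \<and> c = a then 1 else 0 :: rat) \<noteq> 0 \<longrightarrow> c \<in> puiseux_support b"
  proof (cases "a \<ge> 0")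
    case True
    obtain m n where mn: "quotient_of a = (m, n)" by (cases "quotient_of a")
    have n: "n > 0" and a: "a = of_int m / of_int n"
      using quotient_of_denom_pos[OF mn] quotient_of_div[OF mn] by auto
    have m: "m \<ge> 0" using True a n by (auto simp: zero_le_divide_iff)
    have "a = of_nat (nat m) / of_nat (nat n)" using a m n by (simp add: of_nat_nat)
    then have "a \<in> puiseux_support (nat n)" unfolding puiseux_support_def by blast
    then show ?thesis using n by (intro exI[of _ "nat n"]) auto
  qed auto
qed

instantiation puiseux :: "{zero, one, plus, minus, uminus, times}"
begin

lemma puiseux_common_support:
  fixes f g :: "rat \<Rightarrow> rat"
  assumes "\<exists>b\<ge>1. \<forall>a. f a \<noteq> 0 \<longrightarrow> a \<in> puiseux_support b"
    and "\<exists>b\<ge>1. \<forall>a. g a \<noteq> 0 \<longrightarrow> a \<in> puiseux_support b"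
  shows "\<exists>b\<ge>1. (\<forall>a. f a \<noteq> 0 \<longrightarrow> a \<in> puiseux_support b) \<and> (\<forall>a. g a \<noteq> 0 \<longrightarrow> a \<in> puiseux_support b)"
proof -
  obtain b c where b: "b \<ge> 1" "\<forall>a. f a \<noteq> 0 \<longrightarrow> a \<in> puiseux_support b"
    and c: "c \<ge> 1" "\<forall>a. g a \<noteq> 0 \<longrightarrow> a \<in> puiseux_support c"
    using assms by blast
  have "puiseux_support b \<subseteq> puiseux_support (b * c)" "puiseux_support c \<subseteq> puiseux_support (b * c)"
    using puiseux_support_mono[of c b] puiseux_support_mono[of b c] b c by (auto simp: mult.commute)
  moreover have "b * c \<ge> 1" using b c by simp
  ultimately show ?thesis using b(2) c(2) by (intro exI[of _ "b * c"]) auto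
qed

lift_definition zero_puiseux :: puiseux is "\<lambda>_. 0" by auto

definition one_puiseux :: puiseux where "one_puiseux = qpow 0"

lift_definition plus_puiseux :: "puiseux \<Rightarrow> puiseux \<Rightarrow> puiseux" is "\<lambda>f g a. f a + g a"
proof -
  fix f g :: "rat \<Rightarrow> rat"
  assume "\<exists>b\<ge>1. \<forall>a. f a \<noteq> 0 \<longrightarrow> a \<in> puiseux_support b"
    and "\<exists>b\<ge>1. \<forall>a. g a \<noteq> 0 \<longrightarrow> a \<in> puiseux_support b"
  from puiseux_common_support[OF this] obtain b where b: "b \<ge> 1"
    and "\<And>a. f a \<noteq> 0 \<Longrightarrow> a \<in> puiseux_support b" "\<And>a. g a \<noteq> 0 \<Longrightarrow> a \<in> puiseux_support b"
    by blast
  then have "\<forall>a. f a + g a \<noteq> 0 \<longrightarrow> a \<in> puiseux_support b" by force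
  then show "\<exists>b\<ge>1. \<forall>a. f a + g a \<noteq> 0 \<longrightarrow> a \<in> puiseux_support b" using b by blast
qed

lift_definition minus_puiseux :: "puiseux \<Rightarrow> puiseux \<Rightarrow> puiseux" is "\<lambda>f g a. f a - g a"
proof -
  fix f g :: "rat \<Rightarrow> rat"
  assume "\<exists>b\<ge>1. \<forall>a. f a \<noteq> 0 \<longrightarrow> a \<in> puiseux_support b"
    and "\<exists>b\<ge>1. \<forall>a. g a \<noteq> 0 \<longrightarrow> a \<in> puiseux_support b"
  from puiseux_common_support[OF this] obtain b where b: "b \<ge> 1"
    and "\<And>a. f a \<noteq> 0 \<Longrightarrow> a \<in> puiseux_support b" "\<And>a. g a \<noteq> 0 \<Longrightarrow> a \<in> puiseux_support b"
    by blast
  then have "\<forall>a. f a - g a \<noteq> 0 \<longrightarrow> a \<in> puiseux_support b" by force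
  then show "\<exists>b\<ge>1. \<forall>a. f a - g a \<noteq> 0 \<longrightarrow> a \<in> puiseux_support b" using b by blast
qed

lift_definition uminus_puiseux :: "puiseux \<Rightarrow> puiseux" is "\<lambda>f a. - f a"
  by auto

lift_definition times_puiseux :: "puiseux \<Rightarrow> puiseux \<Rightarrow> puiseux" is conv
proof -
  fix f g :: "rat \<Rightarrow> rat"
  assume "\<exists>b\<ge>1. \<forall>a. f a \<noteq> 0 \<longrightarrow> a \<in> puiseux_support b"
    and "\<exists>b\<ge>1. \<forall>a. g a \<noteq> 0 \<longrightarrow> a \<in> puiseux_support b"
  then obtain b where b: "b \<ge> 1" "\<forall>a. f a \<noteq> 0 \<longrightarrow> a \<in> puiseux_support b"
    "\<forall>a. g a \<noteq> 0 \<longrightarrow> a \<in> puiseux_support b"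
    using puiseux_common_support[of f g] by auto
  obtain f' g' where "f = subst_root_coeff b f'" "g = subst_root_coeff b g'"
    by (rule that[OF eq_subst_root_coeff[OF b(1,2)] eq_subst_root_coeff[OF b(1,3)]])
  then have "conv f g = subst_root_coeff b (f' * g')"
    using conv_subst_root_coeff[OF b(1)] by (simp only:)
  then show "\<exists>b\<ge>1. \<forall>a. conv f g a \<noteq> 0 \<longrightarrow> a \<in> puiseux_support b"
    using b(1) subst_root_coeff_outside[of _ b] by (intro exI[of _ b]) auto
qed

instance ..

end

lemma subst_root_add: "b \<ge> 1 \<Longrightarrow> subst_root b (f + g) = subst_root b f + subst_root b g"
  by transfer (auto simp: subst_root_coeff_def fun_eq_iff)

lemma subst_root_diff: "b \<ge> 1 \<Longrightarrow> subst_root b (f - g) = subst_root b f - subst_root b g"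
  by transfer (auto simp: subst_root_coeff_def fun_eq_iff)

lemma subst_root_uminus: "b \<ge> 1 \<Longrightarrow> subst_root b (- f) = - subst_root b f"
  by transfer (auto simp: subst_root_coeff_def fun_eq_iff)

lemma subst_root_mult: "b \<ge> 1 \<Longrightarrow> subst_root b (f * g) = subst_root b f * subst_root b g"
  by transfer (auto simp: conv_subst_root_coeff)

lemma subst_root_0: "b \<ge> 1 \<Longrightarrow> subst_root b 0 = 0"
  by transfer (auto simp: subst_root_coeff_def fun_eq_iff)

lemma subst_root_X_power:
  assumes "b \<ge> 1"
  shows "subst_root b (fps_X ^ n) = qpow (of_nat n / of_nat b)"
proof (rule puiseux_eqI)
  fix a
  have b: "(of_nat b :: rat) \<noteq> 0" using assms by simp
  show "pcoeff (subst_root b (fps_X ^ n)) a = pcoeff (qpow (of_nat n / of_nat b)) a"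
  proof (cases "a \<in> puiseux_support b")
    case True
    then obtain m where "a = of_nat m / of_nat b" by (auto simp: puiseux_support_def)
    then show ?thesis using assms b
      by (auto simp: subst_root.rep_eq qpow.rep_eq fps_X_power_nth)
  next
    case False
    then have "a \<noteq> of_nat n / of_nat b" unfolding puiseux_support_def by blast
    then show ?thesis using assms False
      by (simp add: subst_root.rep_eq qpow.rep_eq subst_root_coeff_outside)
  qed
qed

lemma subst_root_1: "b \<ge> 1 \<Longrightarrow> subst_root b 1 = 1"
  using subst_root_X_power[of b 0] by (simp add: one_puiseux_def)

lemma subst_root_refine:
  assumes "b \<ge> 1" "c \<ge> 1"
  shows "\<exists>g. subst_root b f = subst_root (b * c) g"
proof -
  have supp: "\<forall>a. pcoeff (subst_root b f) a \<noteq> 0 \<longrightarrow> a \<in> puiseux_support (b * c)"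
    using assms puiseux_support_mono[OF assms(2), of b] subst_root_coeff_outside
    by (auto simp: subst_root.rep_eq)
  have bc: "b * c \<ge> 1" using assms by simp
  obtain g where "pcoeff (subst_root b f) = subst_root_coeff (b * c) g"
    by (rule that[OF eq_subst_root_coeff[OF bc supp]])
  also have "\<dots> = pcoeff (subst_root (b * c) g)" using bc by (simp add: subst_root.rep_eq)
  finally show ?thesis unfolding pcoeff_inject by blast
qed

lemma puiseux_eq_subst_root: "\<exists>b\<ge>1. \<exists>f. F = subst_root b f"
proof -
  obtain b where b: "b \<ge> 1" "\<forall>a. pcoeff F a \<noteq> 0 \<longrightarrow> a \<in> puiseux_support b"
    using pcoeff[of F] by auto
  obtain f where "pcoeff F = subst_root_coeff b f" by (rule that[OF eq_subst_root_coeff[OF b]])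
  also have "\<dots> = pcoeff (subst_root b f)" using b(1) by (simp add: subst_root.rep_eq)
  finally show ?thesis unfolding pcoeff_inject using b(1) by blast
qed

lemma puiseux_eq_subst_root3:
  obtains b f g h where "b \<ge> 1" "F = subst_root b f" "G = subst_root b g" "H = subst_root b h"
proof -
  obtain b f where b: "b \<ge> 1" "F = subst_root b f" using puiseux_eq_subst_root by blast
  obtain c g where c: "c \<ge> 1" "G = subst_root c g" using puiseux_eq_subst_root by blast
  obtain d h where d: "d \<ge> 1" "H = subst_root d h" using puiseux_eq_subst_root by blast
  have ge: "c * d \<ge> 1" "b * d \<ge> 1" "b * c \<ge> 1" "b * (c * d) \<ge> 1" using b c d by simp_all
  obtain f' where f': "subst_root b f = subst_root (b * (c * d)) f'"
    using subst_root_refine[OF b(1) ge(1)] by blast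
  obtain g' where g': "subst_root c g = subst_root (c * (b * d)) g'"
    using subst_root_refine[OF c(1) ge(2)] by blast
  obtain h' where h': "subst_root d h = subst_root (d * (b * c)) h'"
    using subst_root_refine[OF d(1) ge(3)] by blast
  have "c * (b * d) = b * (c * d)" "d * (b * c) = b * (c * d)" by (simp_all add: ac_simps)
  then show ?thesis using that[OF ge(4), of f' g' h'] b(2) c(2) d(2) f' g' h' by (simp only:)
qed

instance puiseux :: comm_ring_1
proof
  fix F G H :: puiseux
  obtain b f g h where b: "b \<ge> 1"
    and FGH: "F = subst_root b f" "G = subst_root b g" "H = subst_root b h"
    by (rule puiseux_eq_subst_root3)
  note s = FGH subst_root_mult[OF b, symmetric] subst_root_add[OF b, symmetric]
    subst_root_1[OF b, symmetric]
  show "F * G * H = F * (G * H)" by (simp add: s mult.assoc)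
  show "F * G = G * F" by (simp add: s mult.commute)
  show "1 * F = F" by (simp add: s)
  show "(F + G) * H = F * H + G * H" by (simp add: s algebra_simps)
  show "F + G + H = F + (G + H)" by transfer (simp add: fun_eq_iff)
  show "F + G = G + F" by transfer (simp add: fun_eq_iff)
  show "0 + F = F" by transfer (simp add: fun_eq_iff)
  show "- F + F = 0" by transfer (simp add: fun_eq_iff)
  show "F - G = F + - G" by transfer (simp add: fun_eq_iff)
  show "(0::puiseux) \<noteq> 1"
    unfolding one_puiseux_def by transfer (auto simp: fun_eq_iff)
qed

text \<open>
  The quotient \<open>F / G\<close> is the ring quotient whenever \<open>G\<close> is a unit, which is the case exactly when
  the constant coefficient of \<open>G\<close> is nonzero; inverses of non-units are set to 0.
\<close>

instantiation puiseux :: inverse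
begin

definition inverse_puiseux :: "puiseux \<Rightarrow> puiseux" where
  "inverse F = (if F dvd 1 then THE G. F * G = 1 else 0)" for F :: puiseux

definition divide_puiseux :: "puiseux \<Rightarrow> puiseux \<Rightarrow> puiseux" where
  "F div G = F * inverse G" for F G :: puiseux

instance ..

end

lemma puiseux_mult_inverse:
  assumes "F dvd (1 :: puiseux)"
  shows "F * inverse F = 1"
proof -
  obtain G where G: "F * G = 1" using assms by (auto simp: dvd_def)
  have uniq: "G' = G" if G': "F * G' = 1" for G'
  proof -
    have "G' = (F * G) * G'" using G by simp
    also have "\<dots> = G * (F * G')" by (simp only: ac_simps)
    finally show ?thesis using G' by simp
  qed
  have "(THE G. F * G = 1) = G" by (rule the_equality) (fact G, fact uniq)
  with assms G show ?thesis by (simp add: inverse_puiseux_def)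
qed

lemma pcoeff_subst_root_0: "b \<ge> 1 \<Longrightarrow> pcoeff (subst_root b f) 0 = fps_nth f 0"
  using subst_root_coeff_of_nat[of b f 0] by (simp add: subst_root.rep_eq)

lemma puiseux_unit_iff: "F dvd 1 \<longleftrightarrow> pcoeff F 0 \<noteq> 0"
proof
  assume "F dvd 1"
  then obtain G where G: "F * G = 1" by (auto simp: dvd_def)
  obtain b f g h where b: "b \<ge> 1" and FG: "F = subst_root b f" "G = subst_root b g"
    by (rule puiseux_eq_subst_root3[of F G 0])
  have "pcoeff (subst_root b (f * g)) 0 = pcoeff 1 0"
    using G FG by (simp add: subst_root_mult[OF b])
  then have "fps_nth f 0 * fps_nth g 0 = 1"
    by (simp add: pcoeff_subst_root_0[OF b] one_puiseux_def qpow.rep_eq)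
  then show "pcoeff F 0 \<noteq> 0" by (auto simp: FG pcoeff_subst_root_0[OF b])
next
  assume F: "pcoeff F 0 \<noteq> 0"
  obtain b f where b: "b \<ge> 1" and f: "F = subst_root b f" using puiseux_eq_subst_root by blast
  have "fps_nth f 0 \<noteq> 0" using F by (simp add: f pcoeff_subst_root_0[OF b])
  then have "f * inverse f = 1" by (simp add: inverse_mult_eq_1')
  then have "F * subst_root b (inverse f) = 1"
    using subst_root_mult[OF b, of f "inverse f"] by (simp add: f subst_root_1[OF b])
  then show "F dvd 1" by (intro dvdI[of _ _ "subst_root b (inverse f)"]) simp
qed

definition integer_trace :: "puiseux \<Rightarrow> rat fps" where
  "integer_trace F = Abs_fps (\<lambda>d. pcoeff F (of_nat d))"

definition puiseux_ge :: "puiseux \<Rightarrow> puiseux \<Rightarrow> bool"  (infix "\<ge>\<^sub>q" 50) where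
  "F \<ge>\<^sub>q G \<longleftrightarrow> (\<forall>d. fps_nth (integer_trace (F - G)) d \<ge> 0)"

text \<open>\<open>gauss_binomial r k\<close> is the coefficient with upper entry \<open>r + k\<close> and lower entry \<open>k\<close>.\<close>

definition gauss_binomial :: "rat \<Rightarrow> nat \<Rightarrow> puiseux" where
  "gauss_binomial r k =
     (\<Prod>i=1..k. 1 - qpow (r + of_nat i)) / (\<Prod>i=1..k. 1 - qpow (of_nat i))"

lemma gauss_binomial_mult_denominator:
  "gauss_binomial r k * (\<Prod>i=1..k. 1 - qpow (of_nat i)) = (\<Prod>i=1..k. 1 - qpow (r + of_nat i))"
proof -
  have "1 - qpow (of_nat i) dvd 1" if "i \<in> {1..k}" for i
    using that unfolding puiseux_unit_iff
    by (simp add: one_puiseux_def minus_puiseux.rep_eq qpow.rep_eq)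
  then have "(\<Prod>i=1..k. 1 - qpow (of_nat i)) dvd (\<Prod>i=1..k. 1)"
    by (intro prod_dvd_prod)
  then have "(\<Prod>i=1..k. 1 - qpow (of_nat i)) dvd 1" by simp
  from puiseux_mult_inverse[OF this] show ?thesis
    unfolding gauss_binomial_def divide_puiseux_def mult.assoc
    by (subst (2) mult.commute) simp
qed

end

theory Submission
  imports Defs
begin

text \<open>
  Write \<open>(q)\<^sub>n = (1 - q) \<dots> (1 - q\<^sup>n)\<close> and \<open>W(a,b) = 1 / ((q)\<^sub>a (q)\<^sub>b)\<close>. The \<open>q\<close>-binomial
  theorem expands the generalized Gaussian binomial as
  \<open>\<Sum>\<^sub>j (-1)\<^sup>j q\<^bsup>rj + j(j+1)/2\<^esup> W(j, k - j)\<close>, and the integer trace keeps the terms with \<open>rj\<close>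
  integral: the even \<open>j\<close> for \<open>r = 1/2\<close> and the multiples of 4 for \<open>r = 1/4\<close>. In the
  difference of the two traces each \<open>j = 4i + 2\<close> contributes a nonnegative series \<open>E i\<close>, and
  each \<open>j = 4i\<close> contributes \<open>- N i\<close> with \<open>N i = (q\<^sup>i - q\<^sup>2\<^sup>i) q\<^bsup>j(j+1)/2\<^esup> W(j, k - j)\<close>.
  Since \<open>N 0 = 0\<close>, it suffices that every other negative term is at most the mean of its two
  positive neighbours, \<open>2 N m \<le> E (m - 1) + E m\<close> coefficientwise (lemma
  \<open>dominated_by_neighbours\<close>).

  Put \<open>b = k - 4m\<close>. After division by a common monomial, the series \<open>E (m - 1)\<close>, \<open>N m\<close> and
  \<open>E m\<close> are \<open>W(4m - 2, b + 2)\<close>, \<open>q\<^bsup>7m\<^esup> (1 - q\<^sup>m) W(4m, b)\<close> and \<open>q\<^bsup>16m+4\<^esup> W(4m + 2, b - 2)\<close>;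
  they share almost all of their denominators. As long as \<open>b\<close> is less than about \<open>12m\<close>, the
  lower neighbour alone beats \<open>2 N m\<close>. Beyond that the two neighbours do so together. The
  heuristic reason is the inequality of the arithmetic and the geometric mean at a real \<open>q\<close>:
  \<open>W(4m - 2, b + 2)\<close> and \<open>W(4m + 2, b - 2)\<close> are roughly \<open>t W(4m, b)\<close> and \<open>W(4m, b) / t\<close> for
  some \<open>t\<close>, so that the mean of the neighbours is about \<open>q\<^bsup>8m+2\<^esup> W(4m, b)\<close> or more, and near
  \<open>q = 1\<close> the factor \<open>1 - q\<^sup>m\<close> makes \<open>N m\<close> much smaller than that.

  The reduction to a finite computation rests on one observation (\<open>geo_1_antimono\<close>): in the
  presence of a factor \<open>1/(1 - q)\<close>, enlarging any \<open>d\<close> in a factor \<open>1/(1 - q\<^sup>d)\<close>, or an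
  exponent of a monomial, makes all coefficients smaller or equal. Hence all the part sizes
  involved can be rounded to multiples of \<open>m\<close>, downwards in \<open>N m\<close> and upwards in its
  neighbours, and both cases become the nonnegativity of one explicit rational function of
  \<open>Y = q\<^sup>m\<close>, in which neither \<open>m\<close> nor \<open>b\<close> occurs (\<open>balance_lower\<close>, \<open>balance_both\<close>). These
  two functions are settled by a certificate that inspects finitely many coefficients.
\<close>

text \<open>
  The part size 1 is a literal argument throughout; unfolding it to a successor would hide
  it from the rewrite rules below.
\<close>

declare One_nat_def [simp del]

section \<open>Coefficientwise comparison of power series\<close>

definition fps_le :: "rat fps \<Rightarrow> rat fps \<Rightarrow> bool" (infix "\<preceq>" 50) where
  "f \<preceq> g \<longleftrightarrow> (\<forall>n. fps_nth f n \<le> fps_nth g n)"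

lemma fps_leI: "(\<And>n. fps_nth f n \<le> fps_nth g n) \<Longrightarrow> f \<preceq> g"
  by (simp add: fps_le_def)

lemma fps_le_refl [simp]: "f \<preceq> f"
  by (simp add: fps_le_def)

lemma fps_le_trans [trans]: "f \<preceq> g \<Longrightarrow> g \<preceq> h \<Longrightarrow> f \<preceq> h"
  unfolding fps_le_def by (meson order_trans)

lemma fps_le_iff_diff: "f \<preceq> g \<longleftrightarrow> 0 \<preceq> g - f"
  by (simp add: fps_le_def)

lemma fps_le_add: "f \<preceq> g \<Longrightarrow> f' \<preceq> g' \<Longrightarrow> f + f' \<preceq> g + g'"
  by (simp add: fps_le_def add_mono)

lemma fps_nonneg_mult: "0 \<preceq> f \<Longrightarrow> 0 \<preceq> g \<Longrightarrow> 0 \<preceq> f * g"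
  by (auto simp: fps_le_def fps_mult_nth intro!: sum_nonneg)

lemma fps_nonneg_X_power [simp]: "0 \<preceq> fps_X ^ n"
  by (simp add: fps_le_def fps_X_power_nth)

lemma fps_nonneg_one [simp]: "0 \<preceq> 1"
  by (simp add: fps_le_def)

lemma fps_nonneg_two: "0 \<preceq> 2"
  by (simp add: fps_le_def numeral_fps_const)

lemma fps_nonneg_prod: "(\<And>i. i \<in> A \<Longrightarrow> 0 \<preceq> f i) \<Longrightarrow> 0 \<preceq> prod f A"
  by (induction A rule: infinite_finite_induct) (auto intro: fps_nonneg_mult)

lemma fps_mult_left_mono: "0 \<preceq> c \<Longrightarrow> f \<preceq> g \<Longrightarrow> c * f \<preceq> c * g"
  using fps_nonneg_mult[of c "g - f"]
  by (simp add: fps_le_iff_diff[of _ "_ * _"] fps_le_iff_diff[of f] right_diff_distrib)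

section \<open>Products of geometric series\<close>

definition geo :: "nat \<Rightarrow> rat fps" where
  "geo d = Abs_fps (\<lambda>n. if d dvd n then 1 else 0)"

lemma geo_nonneg [simp]: "0 \<preceq> geo d"
  by (simp add: fps_le_def geo_def)

lemma geo_inverse:
  assumes "d > 0"
  shows "geo d * (1 - fps_X ^ d) = 1"
proof (rule fps_ext)
  fix n
  have "fps_nth (geo d * fps_X ^ d) n = (if n < d then 0 else fps_nth (geo d) (n - d))"
    by (rule fps_X_power_mult_right_nth)
  then show "fps_nth (geo d * (1 - fps_X ^ d)) n = fps_nth 1 n"
    using assms by (auto simp: right_diff_distrib geo_def dvd_minus_self dvd_imp_le not_less)
qed

lemma geo_unique:
  assumes "d > 0" "f * (1 - fps_X ^ d) = 1"
  shows "f = geo d"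
proof -
  have "f = f * (geo d * (1 - fps_X ^ d))" using geo_inverse[OF assms(1)] by simp
  also have "\<dots> = (f * (1 - fps_X ^ d)) * geo d" by (simp only: ac_simps)
  finally show ?thesis using assms(2) by simp
qed

lemma geo_dvd_antimono: "d dvd e \<Longrightarrow> geo e \<preceq> geo d"
  by (auto simp: fps_le_def geo_def)

lemma cancel_geo:
  assumes "0 < m"
  shows "(1 - fps_X ^ m) * (geo m * f) = f"
proof -
  have "(1 - fps_X ^ m) * (geo m * f) = (geo m * (1 - fps_X ^ m)) * f" by (simp only: ac_simps)
  then show ?thesis by (simp only: geo_inverse[OF assms] mult_1)
qed

definition geos :: "nat list \<Rightarrow> rat fps" where
  "geos ds = prod_list (map geo ds)"

lemma geos_simps [simp]: "geos [] = 1" "geos (d # ds) = geo d * geos ds"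
  by (simp_all add: geos_def)

lemma geos_nonneg [simp]: "0 \<preceq> geos ds"
  by (induction ds) (auto intro: fps_nonneg_mult)

lemma one_le_geos: "1 \<preceq> geos ds"
proof (induction ds)
  case (Cons d ds)
  have "1 \<preceq> geo d" using geo_dvd_antimono[of d 0] by (auto simp: fps_le_def geo_def)
  also have "geo d = geo d * 1" by simp
  also have "geo d * 1 \<preceq> geo d * geos ds" using Cons by (intro fps_mult_left_mono) simp
  finally show ?case by simp
qed simp

lemma geo_1_mult_nth: "fps_nth (geo 1 * f) n = (\<Sum>i\<le>n. fps_nth f i)"
proof -
  have "fps_nth (f * geo 1) n = (\<Sum>i\<le>n. fps_nth f i)"
    by (simp add: fps_mult_nth geo_def atMost_atLeast0)
  then show ?thesis by (simp add: mult.commute)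
qed

lemma geo_1_geo_nth:
  assumes "d > 0"
  shows "fps_nth (geo 1 * geo d) n = of_nat (n div d) + 1"
proof (induction n)
  case (Suc n)
  have "Suc n div d = (if d dvd Suc n then Suc (n div d) else n div d)"
    by (simp add: div_Suc dvd_eq_mod_eq_0)
  moreover have "fps_nth (geo 1 * geo d) (Suc n) =
      fps_nth (geo 1 * geo d) n + (if d dvd Suc n then 1 else 0)"
    unfolding geo_1_mult_nth by (simp add: geo_def)
  ultimately show ?case using Suc by simp
qed (simp add: geo_1_mult_nth geo_def)

text \<open>
  Coefficient \<open>n\<close> on either side counts the multiples of the part size up to \<open>n\<close>. The factor
  \<open>geo 1\<close> is essential: \<open>geo e\<close> and \<open>geo d\<close> themselves are comparable only when \<open>d\<close> divides
  \<open>e\<close>.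
\<close>

lemma geo_1_geo_antimono:
  assumes "0 < d" "d \<le> e"
  shows "geo 1 * geo e \<preceq> geo 1 * geo d"
  using assms by (intro fps_leI) (simp add: geo_1_geo_nth div_le_mono2)

lemma geo_1_X_power_antimono:
  assumes "s \<le> t"
  shows "geo 1 * fps_X ^ t \<preceq> geo 1 * fps_X ^ s"
  using assms by (intro fps_leI) (simp add: fps_X_power_mult_right_nth geo_def)

text \<open>
  The rounding principle: a single factor \<open>geo 1\<close> pays for the replacement of all parts,
  because the parts can be exchanged one after the other while the remaining factors stay
  nonnegative.
\<close>

lemma geo_1_antimono:
  assumes "list_all2 (\<le>) ds es" "0 \<notin> set ds" "s \<le> t"
  shows "geo 1 * (fps_X ^ t * geos es) \<preceq> geo 1 * (fps_X ^ s * geos ds)"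
  using assms
proof (induction ds es rule: list_all2_induct)
  case Nil
  then show ?case using geo_1_X_power_antimono by simp
next
  case (Cons d ds e es)
  have "geo 1 * (fps_X ^ t * geos (e # es)) = geo e * (geo 1 * (fps_X ^ t * geos es))"
    by (simp add: ac_simps)
  also have "\<dots> \<preceq> geo e * (geo 1 * (fps_X ^ s * geos ds))"
    using Cons by (intro fps_mult_left_mono geo_nonneg Cons.IH) auto
  also have "\<dots> = (fps_X ^ s * geos ds) * (geo 1 * geo e)"
    by (simp add: ac_simps)
  also have "\<dots> \<preceq> (fps_X ^ s * geos ds) * (geo 1 * geo d)"
    using Cons by (intro fps_mult_left_mono fps_nonneg_mult geo_1_geo_antimono) auto
  also have "\<dots> = geo 1 * (fps_X ^ s * geos (d # ds))"
    by (simp add: ac_simps)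
  finally show ?case .
qed

text \<open>
  Dilation is the substitution \<open>q \<mapsto> q\<^sup>m\<close>. It turns an inequality between fixed rational
  functions of \<open>Y\<close> into one between series whose parts are multiples of \<open>m\<close>.
\<close>

abbreviation dilate :: "nat \<Rightarrow> rat fps \<Rightarrow> rat fps" where
  "dilate m f \<equiv> f oo fps_X ^ m"

lemma dilate_nth:
  assumes "0 < m"
  shows "fps_nth (dilate m f) n = (if m dvd n then fps_nth f (n div m) else 0)"
proof -
  have "fps_nth (dilate m f) n = (\<Sum>i\<le>n. if n = m * i then fps_nth f i else 0)"
    unfolding fps_compose_nth atLeast0AtMost
    by (intro sum.cong) (auto simp: power_mult[symmetric] fps_X_power_nth)
  also have "\<dots> = (\<Sum>i\<in>{i. i \<le> n \<and> n = m * i}. fps_nth f i)"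
    using sum.inter_filter[of "{..n}" "fps_nth f" "\<lambda>i. n = m * i"] by simp
  also have "{i. i \<le> n \<and> n = m * i} = (if m dvd n then {n div m} else {})"
    using assms by auto
  finally show ?thesis by simp
qed

lemma dilate_nonneg: "0 \<preceq> f \<Longrightarrow> 0 < m \<Longrightarrow> 0 \<preceq> dilate m f"
  by (simp add: fps_le_def dilate_nth)

lemma dilate_mult: "0 < m \<Longrightarrow> dilate m (f * g) = dilate m f * dilate m g"
  by (simp add: fps_compose_mult_distrib)

lemma dilate_X_power: "0 < m \<Longrightarrow> dilate m (fps_X ^ n) = fps_X ^ (m * n)"
  by (simp add: fps_compose_power[symmetric] power_mult)

lemma dilate_geo:
  assumes "0 < m" "0 < d"
  shows "dilate m (geo d) = geo (m * d)"
proof (rule geo_unique)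
  have "dilate m (geo d * (1 - fps_X ^ d)) = dilate m 1" by (simp only: geo_inverse[OF assms(2)])
  then show "dilate m (geo d) * (1 - fps_X ^ (m * d)) = 1"
    using assms by (simp add: dilate_mult fps_compose_sub_distrib dilate_X_power)
qed (use assms in simp)

text \<open>
  Nonnegativity of \<open>f/(1 - Y)\<close> is weaker than that of \<open>f\<close>; it suffices because \<open>1/(1 - q)\<close>
  is \<open>1/(1 - Y)\<close> times the polynomial \<open>1 + q + \<dots> + q\<^bsup>m-1\<^esup>\<close> at \<open>Y = q\<^sup>m\<close>.
\<close>

lemma geo_1_dilate_nonneg:
  assumes "0 < m" "0 \<preceq> geo 1 * f"
  shows "0 \<preceq> geo 1 * dilate m f"
proof -
  have "geo 1 * dilate m f = geo 1 * (1 - fps_X ^ m) * dilate m (geo 1 * f)"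
  proof -
    have "geo 1 * (1 - fps_X ^ m) * dilate m (geo 1 * f) = geo 1 * (geo m * (1 - fps_X ^ m)) * dilate m f"
      using assms by (simp add: dilate_mult dilate_geo ac_simps)
    also have "\<dots> = geo 1 * dilate m f" by (simp only: geo_inverse[OF assms(1)] mult_1_right)
    finally show ?thesis by (rule sym)
  qed
  moreover have "0 \<preceq> geo 1 * (1 - fps_X ^ m)"
    using geo_1_X_power_antimono[of 0 m] by (simp add: fps_le_iff_diff[of "_ * _"] right_diff_distrib)
  ultimately show ?thesis
    using dilate_nonneg[OF assms(2,1)] by (metis fps_nonneg_mult)
qed

section \<open>A finite certificate for nonnegative coefficients\<close>

fun fps_of_list :: "int list \<Rightarrow> rat fps" where
  "fps_of_list [] = 0"
| "fps_of_list (x # xs) = fps_const (of_int x) + fps_X * fps_of_list xs"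

fun list_add :: "int list \<Rightarrow> int list \<Rightarrow> int list" where
  "list_add [] ys = ys"
| "list_add xs [] = xs"
| "list_add (x # xs) (y # ys) = (x + y) # list_add xs ys"

text \<open>
  Coefficient list of \<open>c q\<^sup>d\<close> times the given polynomial; \<open>c = -1\<close> gives the subtracted half
  of a multiplication by \<open>1 - q\<^sup>d\<close>.
\<close>

definition list_shift :: "int \<Rightarrow> nat \<Rightarrow> int list \<Rightarrow> int list" where
  "list_shift c d xs = replicate d 0 @ map ((*) c) xs"

definition list_mult_factor :: "nat \<Rightarrow> int list \<Rightarrow> int list" where
  "list_mult_factor d xs = list_add xs (list_shift (- 1) d xs)"

definition list_factors :: "nat list \<Rightarrow> int list" where
  "list_factors ds = foldr list_mult_factor ds [1]"

lemma fps_of_list_add: "fps_of_list (list_add xs ys) = fps_of_list xs + fps_of_list ys"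
  by (induction xs ys rule: list_add.induct)
    (auto simp: algebra_simps fps_const_add[symmetric] simp del: fps_const_add)

lemma fps_of_list_shift: "fps_of_list (list_shift c d xs) = of_int c * fps_X ^ d * fps_of_list xs"
proof (induction d)
  case 0
  show ?case
    by (induction xs) (auto simp: list_shift_def algebra_simps fps_of_int[symmetric] fps_const_mult[symmetric]
        simp del: fps_const_mult)
qed (simp add: list_shift_def algebra_simps)

lemma fps_of_list_factors: "fps_of_list (list_factors ds) = (\<Prod>d\<leftarrow>ds. 1 - fps_X ^ d)"
  by (induction ds)
    (simp_all add: list_factors_def list_mult_factor_def fps_of_list_add fps_of_list_shift algebra_simps)

lemma fps_of_list_nth:
  "fps_nth (fps_of_list xs) n = (if n < length xs then of_int (xs ! n) else 0)"
  by (induction xs arbitrary: n) (auto simp: nth_Cons split: nat.splits)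

text \<open>
  Power series division by \<open>1 - q\<^sup>d\<close>, truncated to the length of the dividend. The first
  argument is a queue with the last \<open>d\<close> coefficients of the quotient, initially zero.
\<close>

fun list_div :: "int list \<Rightarrow> int list \<Rightarrow> int list" where
  "list_div (b # bs) (x # xs) = (x + b) # list_div (bs @ [x + b]) xs"
| "list_div _ _ = []"

lemma length_list_div [simp]: "bs \<noteq> [] \<Longrightarrow> length (list_div bs xs) = length xs"
  by (induction bs xs rule: list_div.induct) auto

lemma list_div_nth:
  assumes "bs \<noteq> []" "n < length xs"
  shows "list_div bs xs ! n = xs ! n + (bs @ list_div bs xs) ! n"
  using assms
proof (induction bs xs arbitrary: n rule: list_div.induct)
  case (1 b bs x xs)
  show ?case
  proof (cases n)
    case (Suc i)
    have "list_div (b # bs) (x # xs) ! n = list_div (bs @ [x + b]) xs ! i"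
      by (simp add: Suc)
    also have "\<dots> = xs ! i + ((bs @ [x + b]) @ list_div (bs @ [x + b]) xs) ! i"
      using "1.prems" Suc by (intro "1.IH") auto
    finally show ?thesis by (simp add: Suc)
  qed simp
qed auto

definition starts_with :: "rat fps \<Rightarrow> int list \<Rightarrow> bool" where
  "starts_with f xs \<longleftrightarrow> (\<forall>n<length xs. fps_nth f n = of_int (xs ! n))"

lemma geo_mult_nth:
  assumes "d > 0"
  shows "fps_nth (geo d * f) n = fps_nth f n + (if n < d then 0 else fps_nth (geo d * f) (n - d))"
proof -
  have "f = geo d * (1 - fps_X ^ d) * f" using geo_inverse[OF assms] by simp
  also have "\<dots> = geo d * f - fps_X ^ d * (geo d * f)" by (simp add: algebra_simps)
  finally have "fps_nth f n = fps_nth (geo d * f - fps_X ^ d * (geo d * f)) n" by simp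
  then show ?thesis by (simp add: fps_X_power_mult_nth)
qed

lemma starts_with_geo_mult:
  assumes "starts_with f xs" "d > 0"
  shows "starts_with (geo d * f) (list_div (replicate d 0) xs)"
proof -
  let ?ys = "list_div (replicate d 0) xs"
  have "fps_nth (geo d * f) n = of_int (?ys ! n)" if "n < length xs" for n
    using that
  proof (induction n rule: less_induct)
    case (less n)
    have "?ys ! n = xs ! n + (if n < d then 0 else ?ys ! (n - d))"
      using list_div_nth[of "replicate d 0" n xs] less.prems assms(2)
      by (auto simp: nth_append)
    moreover have "fps_nth (geo d * f) (n - d) = of_int (?ys ! (n - d))" if "\<not> n < d"
      using less that assms(2) by auto
    ultimately show ?case
      using assms less.prems by (subst geo_mult_nth) (auto simp: starts_with_def)
  qed
  then show ?thesis using assms(2) by (simp add: starts_with_def)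
qed

text \<open>
  The list holds an initial segment of a series whose coefficients from \<open>e\<close> on are known to
  be nonnegative. Dividing by \<open>1 - q\<^sup>d\<close> preserves that knowledge as soon as \<open>d\<close> consecutive
  coefficients of the quotient, starting at \<open>e\<close>, are nonnegative, since each later one is
  the sum of the one \<open>d\<close> places before it and a coefficient of the dividend. Coefficients
  below \<open>e\<close> may be negative on the way; only those of the last quotient are inspected.
\<close>

fun nonneg_certificate :: "nat \<Rightarrow> nat list \<Rightarrow> int list \<Rightarrow> bool" where
  "nonneg_certificate e [] xs \<longleftrightarrow> e \<le> length xs \<and> list_all ((\<le>) 0) xs"
| "nonneg_certificate e (d # ds) xs \<longleftrightarrow>
     (let ys = list_div (replicate d 0) xs
      in 0 < d \<and> e + d \<le> length xs \<and> list_all ((\<le>) 0) (drop e ys) \<and> nonneg_certificate e ds ys)"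

lemma nonneg_certificate_sound:
  assumes "nonneg_certificate e ds xs" "starts_with f xs" "\<And>n. e \<le> n \<Longrightarrow> 0 \<le> fps_nth f n"
  shows "0 \<preceq> geos ds * f"
  using assms
proof (induction ds arbitrary: f xs)
  case Nil
  have "0 \<le> fps_nth f n" for n
    using Nil by (cases "e \<le> n") (auto simp: starts_with_def list_all_length)
  then show ?case by (simp add: fps_le_def)
next
  case (Cons d ds)
  define ys where "ys = list_div (replicate d 0) xs"
  have d: "0 < d" "e + d \<le> length xs" "list_all ((\<le>) 0) (drop e ys)" "nonneg_certificate e ds ys"
    using Cons.prems(1) by (auto simp: ys_def Let_def)
  have start: "starts_with (geo d * f) ys"
    unfolding ys_def using Cons.prems(2) d(1) by (rule starts_with_geo_mult)
  have len: "length ys = length xs" using d(1) by (simp add: ys_def)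
  have "0 \<le> fps_nth (geo d * f) n" if "e \<le> n" for n
    using that
  proof (induction n rule: less_induct)
    case (less n)
    show ?case
    proof (cases "n < e + d")
      case True
      have "\<forall>i<length ys - e. 0 \<le> ys ! (e + i)"
        using d(2,3) len by (simp add: list_all_length)
      then have "0 \<le> ys ! n"
        using True d(2) len less.prems by (elim allE[of _ "n - e"]) simp
      then show ?thesis
        using True start d(2) len less.prems by (auto simp: starts_with_def)
    next
      case False
      then show ?thesis
        using less d(1) Cons.prems(3) by (subst geo_mult_nth) auto
    qed
  qed
  from Cons.IH[OF d(4) start this] show ?case by (simp add: ac_simps)
qed

text \<open>
  A polynomial has no coefficients beyond its degree, so the knowledge required at the start
  is free. The padding makes room for the windows to be inspected.
\<close>

lemma nonneg_by_certificate:
  assumes "nonneg_certificate (length xs) ds (xs @ replicate l 0)"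
  shows "0 \<preceq> geos ds * fps_of_list xs"
  by (rule nonneg_certificate_sound[OF assms])
    (auto simp: starts_with_def fps_of_list_nth nth_append)

lemma geos_cancel:
  assumes "mset ds = mset (es @ rs)" "0 \<notin> set es"
  shows "geos ds * (\<Prod>e\<leftarrow>es. 1 - fps_X ^ e) = geos rs"
proof -
  have "geos ds = geos es * geos rs"
    using assms(1) by (metis geos_def map_append mset_map prod_list.append prod_mset_prod_list)
  moreover have "geos es * (\<Prod>e\<leftarrow>es. 1 - fps_X ^ e) = 1"
    using assms(2)
  proof (induction es)
    case (Cons e es)
    then have "geo e * (1 - fps_X ^ e) * (geos es * (\<Prod>e\<leftarrow>es. 1 - fps_X ^ e)) = 1"
      by (simp add: geo_inverse)
    then show ?case by (simp add: ac_simps)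
  qed simp
  ultimately show ?thesis by (simp add: ac_simps)
qed

section \<open>The two balance inequalities\<close>

text \<open>
  The rational function for the lower neighbour alone. Up to the factor \<open>1/(1 - Y\<^sup>1\<^sup>2)\<^sup>2\<close> it
  is \<open>1/(1 - Y)\<^sup>2\<close> minus \<open>1/(1 - Y)\<close> times \<open>2 Y\<^sup>7 (1 + Y\<^sup>3 + Y\<^sup>6 + Y\<^sup>9)(1 + Y\<^sup>4 + Y\<^sup>8)\<close>,
  that is, \<open>n + 1\<close> is compared with twice a counting function that reaches its maximum 12
  only at \<open>n = 24\<close>.
\<close>

lemma balance_lower:
  "0 \<preceq> geo 1 * (geos [1, 12, 12] - 2 * fps_X ^ 7 * geos [3, 4])"
proof -
  \<comment> \<open>The order of the divisions is chosen such that all windows can start at the length of the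
    numerator.\<close>
  define ds :: "nat list" where "ds = [3, 1, 1, 12, 4, 12]"
  define P where
    "P = list_add (list_factors [3, 4]) (list_shift (- 2) 7 (list_factors [1, 12, 12]))"
  have "nonneg_certificate (length P) ds (P @ replicate 12 0)"
    unfolding P_def ds_def by code_simp
  then have "0 \<preceq> geos ds * fps_of_list P" by (rule nonneg_by_certificate)
  also have "geos ds * fps_of_list P =
      geos ds * (\<Prod>d\<leftarrow>[3, 4]. 1 - fps_X ^ d)
      - 2 * fps_X ^ 7 * (geos ds * (\<Prod>d\<leftarrow>[1, 12, 12]. 1 - fps_X ^ d))"
    unfolding P_def fps_of_list_add fps_of_list_shift fps_of_list_factors
    by (simp only: of_int_minus of_int_numeral)
      (simp only: ring_distribs minus_mult_left [symmetric] mult_minus_right ac_simps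
        diff_conv_add_uminus)
  also have "geos ds * (\<Prod>d\<leftarrow>[3, 4]. 1 - fps_X ^ d) = geos [1, 1, 12, 12]"
    by (rule geos_cancel) (simp_all add: ds_def)
  also have "geos ds * (\<Prod>d\<leftarrow>[1, 12, 12]. 1 - fps_X ^ d) = geos [1, 3, 4]"
    by (rule geos_cancel) (simp_all add: ds_def)
  finally show ?thesis by (simp add: algebra_simps)
qed

text \<open>
  The rational function for both neighbours. The factor \<open>geos [2, 2, 3]\<close> that all three
  terms have in common cannot be dropped: without it some coefficients between \<open>Y\<^sup>1\<^sup>7\<close> and
  \<open>Y\<^sup>3\<^sup>5\<close> are negative, and its smoothing effect makes up for them. The exponent 20 and the
  parts \<open>4, 4, 5, 6\<close> are \<open>16m + 4\<close> and \<open>4m - 1, \<dots>, 4m + 2\<close>, rounded up and divided by \<open>m\<close>.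
\<close>

lemma balance_both:
  "0 \<preceq> geo 1 * (geos [1, 2, 2, 3] + fps_X ^ 20 * geos [1, 2, 2, 3, 4, 4, 5, 6]
     - 2 * fps_X ^ 7 * geos [2, 2, 3, 3, 4, 10, 10])"
proof -
  \<comment> \<open>Again an order of division that makes every intermediate window nonnegative.\<close>
  define ds :: "nat list" where "ds = [1, 2, 3, 2, 4, 3, 5, 4, 10, 6, 10, 1]"
  define P where
    "P = list_add (list_factors [3, 4, 4, 5, 6, 10, 10])
       (list_add (list_shift 1 20 (list_factors [3, 10, 10]))
         (list_shift (- 2) 7 (list_factors [1, 4, 5, 6])))"
  have "nonneg_certificate (length P) ds (P @ replicate 10 0)"
    unfolding P_def ds_def by code_simp
  then have "0 \<preceq> geos ds * fps_of_list P" by (rule nonneg_by_certificate)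
  also have "geos ds * fps_of_list P =
      geos ds * (\<Prod>d\<leftarrow>[3, 4, 4, 5, 6, 10, 10]. 1 - fps_X ^ d)
      + fps_X ^ 20 * (geos ds * (\<Prod>d\<leftarrow>[3, 10, 10]. 1 - fps_X ^ d))
      - 2 * fps_X ^ 7 * (geos ds * (\<Prod>d\<leftarrow>[1, 4, 5, 6]. 1 - fps_X ^ d))"
    unfolding P_def fps_of_list_add fps_of_list_shift fps_of_list_factors
    by (simp only: of_int_minus of_int_numeral of_int_1)
      (simp only: ring_distribs minus_mult_left [symmetric] mult_minus_right ac_simps
        diff_conv_add_uminus mult_1)
  also have "geos ds * (\<Prod>d\<leftarrow>[3, 4, 4, 5, 6, 10, 10]. 1 - fps_X ^ d) = geos [1, 1, 2, 2, 3]"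
    by (rule geos_cancel) (simp_all add: ds_def)
  also have "geos ds * (\<Prod>d\<leftarrow>[3, 10, 10]. 1 - fps_X ^ d) = geos [1, 1, 2, 2, 3, 4, 4, 5, 6]"
    by (rule geos_cancel) (simp_all add: ds_def)
  also have "geos ds * (\<Prod>d\<leftarrow>[1, 4, 5, 6]. 1 - fps_X ^ d) = geos [1, 2, 2, 3, 3, 4, 10, 10]"
    by (rule geos_cancel) (simp_all add: ds_def)
  finally show ?thesis by (simp add: algebra_simps)
qed

lemma balance_lower_dilated:
  assumes "0 < m"
  shows "2 * (geo 1 * (fps_X ^ (7 * m) * geos [3 * m, 4 * m])) \<preceq> geo 1 * geos [m, 12 * m, 12 * m]"
  using geo_1_dilate_nonneg[OF assms balance_lower] assms
  unfolding fps_le_iff_diff[of "_ * _"]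
  by (simp add: fps_compose_sub_distrib dilate_mult dilate_geo
      dilate_X_power algebra_simps)

lemma balance_both_dilated:
  assumes "0 < m"
  shows "2 * (geo 1 * (fps_X ^ (7 * m) * geos [2 * m, 2 * m, 3 * m, 3 * m, 4 * m, 10 * m, 10 * m]))
    \<preceq> geo 1 * geos [m, 2 * m, 2 * m, 3 * m]
      + geo 1 * (fps_X ^ (20 * m) * geos [m, 2 * m, 2 * m, 3 * m, 4 * m, 4 * m, 5 * m, 6 * m])"
  using geo_1_dilate_nonneg[OF assms balance_both] assms
  unfolding fps_le_iff_diff[of "_ * _"]
  by (simp add: fps_compose_sub_distrib fps_compose_add_distrib dilate_mult dilate_geo
      dilate_X_power algebra_simps)

section \<open>Partition generating functions\<close>

definition partition_gf :: "nat \<Rightarrow> rat fps" where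
  "partition_gf n = (\<Prod>i=1..n. geo i)"

lemma partition_gf_Suc: "partition_gf (Suc n) = partition_gf n * geo (Suc n)"
  by (simp add: partition_gf_def)

lemma partition_gf_add_2: "partition_gf (n + 2) = partition_gf n * geos [n + 1, n + 2]"
  by (simp add: partition_gf_Suc add_2_eq_Suc' One_nat_def mult.assoc)

lemma partition_gf_nonneg [simp]: "0 \<preceq> partition_gf n"
  unfolding partition_gf_def by (intro fps_nonneg_prod) simp

text \<open>
  Parts of distinct sizes may be split off at once, and the cofactor is again a product of
  geometric series. This provides the common factors of the three neighbouring terms.
\<close>

lemma partition_gf_factor:
  assumes "distinct ds" "set ds \<subseteq> {1..n}"
  obtains r where "0 \<preceq> r" "partition_gf n = r * geos ds"
proof
  show "0 \<preceq> prod geo ({1..n} - set ds)" by (intro fps_nonneg_prod) simp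
  have "partition_gf n = prod geo ({1..n} - set ds) * prod geo (set ds)"
    unfolding partition_gf_def using assms(2) by (intro prod.subset_diff) auto
  also have "prod geo (set ds) = geos ds"
    using assms(1) by (simp add: geos_def prod.distinct_set_conv_list)
  finally show "partition_gf n = prod geo ({1..n} - set ds) * geos ds" .
qed

section \<open>A negative term and its neighbours\<close>

text \<open>
  For \<open>b = 0\<close> the factor \<open>partition_gf b\<close> has no part 1 to round with. Here the parts
  \<open>4m - 1\<close> and \<open>4m\<close> can be exchanged for their divisors 1 and 2, and the two monomials
  \<open>q\<^bsup>7m\<^esup>\<close> are absorbed by the terms \<open>1\<close> and \<open>q\<^sup>m\<close> of \<open>geo m\<close>.
\<close>

lemma dominated_by_lower_empty:
  assumes "0 < m"
  shows "2 * (fps_X ^ (7 * m) * ((1 - fps_X ^ m) * partition_gf (4 * m)))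
    \<preceq> partition_gf (4 * m - 2) * partition_gf 2"
proof -
  define a where "a = 4 * m - 2"
  have a: "4 * m = Suc (Suc a)" using assms unfolding a_def by arith
  have pa: "partition_gf (4 * m) = partition_gf a * geos [Suc a, 4 * m]"
    using partition_gf_Suc[of a] partition_gf_Suc[of "Suc a"] a by (simp add: mult.assoc)
  obtain r where r: "0 \<preceq> r" "partition_gf a = r * geos [m]"
    by (rule partition_gf_factor[of "[m]" a]) (use assms in \<open>auto simp: a_def\<close>)
  have two: "partition_gf 2 = geo 1 * geo 2"
    using partition_gf_Suc[of 1] partition_gf_Suc[of 0]
    by (simp add: partition_gf_def numeral_2_eq_2 One_nat_def)
  have le: "2 * (fps_X ^ (7 * m) * geo 1) \<preceq> geo 1 * geo m"
  proof (rule fps_leI)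
    fix n
    have "fps_nth (2 * (fps_X ^ (7 * m) * geo 1)) n = (if n < 7 * m then 0 else 2)" for n
      by (simp add: fps_X_power_mult_nth geo_def numeral_fps_const)
    moreover have "1 \<le> n div m" if "\<not> n < 7 * m"
      using that assms div_le_mono[of m n m] by simp
    ultimately show "fps_nth (2 * (fps_X ^ (7 * m) * geo 1)) n \<le> fps_nth (geo 1 * geo m) n"
      using geo_1_geo_nth[OF assms, of n] by (simp add: numeral_fps_const)
  qed
  have "2 * (fps_X ^ (7 * m) * ((1 - fps_X ^ m) * partition_gf (4 * m)))
      = r * (2 * (fps_X ^ (7 * m) * ((1 - fps_X ^ m) * (geo m * (geo (Suc a) * geo (4 * m))))))"
    unfolding pa r(2) geos_simps
      by (simp only: ac_simps mult_1_left mult_1_right)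
  also have "\<dots> = r * (2 * fps_X ^ (7 * m) * geo (Suc a)) * geo (4 * m)"
    unfolding cancel_geo[OF assms] by (simp only: ac_simps)
  also have "\<dots> \<preceq> r * (2 * fps_X ^ (7 * m) * geo (Suc a)) * geo 2"
    by (intro fps_mult_left_mono fps_nonneg_mult geo_dvd_antimono r(1) fps_nonneg_two
        fps_nonneg_X_power geo_nonneg) auto
  also have "\<dots> = (r * (2 * fps_X ^ (7 * m)) * geo 2) * geo (Suc a)" by (simp only: ac_simps)
  also have "\<dots> \<preceq> (r * (2 * fps_X ^ (7 * m)) * geo 2) * geo 1"
    by (intro fps_mult_left_mono fps_nonneg_mult geo_dvd_antimono r(1) fps_nonneg_two
        fps_nonneg_X_power geo_nonneg) auto
  also have "\<dots> = (r * geo 2) * (2 * (fps_X ^ (7 * m) * geo 1))" by (simp only: ac_simps)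
  also have "\<dots> \<preceq> (r * geo 2) * (geo 1 * geo m)"
    using r(1) by (intro fps_mult_left_mono fps_nonneg_mult le) simp_all
  also have "\<dots> = partition_gf a * partition_gf 2" by (simp add: r(2) two ac_simps)
  finally show ?thesis by (simp add: a_def)
qed

text \<open>
  The factor \<open>1 - q\<^sup>m\<close> cancels the part \<open>m\<close> of the left-hand side. Afterwards the left-hand
  side has the parts \<open>4m - 1, 4m\<close> where the right-hand side has \<open>m, b + 1, b + 2\<close>;
  everything else is common. Rounding gives \<open>3m, 4m\<close> against \<open>m, 12m, 12m\<close>.
\<close>

lemma dominated_by_lower:
  assumes "0 < m" "0 < b" "b + 2 \<le> 12 * m"
  shows "2 * (fps_X ^ (7 * m) * ((1 - fps_X ^ m) * (partition_gf (4 * m) * partition_gf b)))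
    \<preceq> partition_gf (4 * m - 2) * partition_gf (b + 2)"
proof -
  define a where "a = 4 * m - 2"
  have a: "4 * m = Suc (Suc a)" using assms unfolding a_def by arith
  have pa: "partition_gf (4 * m) = partition_gf a * geos [Suc a, 4 * m]"
    using partition_gf_Suc[of a] partition_gf_Suc[of "Suc a"] a by (simp add: mult.assoc)
  obtain r where r: "0 \<preceq> r" "partition_gf a = r * geos [m]"
    by (rule partition_gf_factor[of "[m]" a]) (use assms in \<open>auto simp: a_def\<close>)
  obtain s where s: "0 \<preceq> s" "partition_gf b = s * geos [1]"
    by (rule partition_gf_factor[of "[1]" b]) (use assms in auto)
  have rs: "0 \<preceq> r * s" using r s by (intro fps_nonneg_mult)
  have "2 * (fps_X ^ (7 * m) * ((1 - fps_X ^ m) * (partition_gf (4 * m) * partition_gf b)))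
      = r * s * (2 * (geo 1 * (fps_X ^ (7 * m) * ((1 - fps_X ^ m) * (geo m * geos [Suc a, 4 * m])))))"
    unfolding pa r(2) s(2) geos_simps
      by (simp only: ac_simps mult_1_left mult_1_right)
  also have "\<dots> = r * s * (2 * (geo 1 * (fps_X ^ (7 * m) * geos [Suc a, 4 * m])))"
    unfolding cancel_geo[OF assms(1)] ..
  also have "\<dots> \<preceq> r * s * (2 * (geo 1 * (fps_X ^ (7 * m) * geos [3 * m, 4 * m])))"
    using assms a by (intro fps_mult_left_mono[OF rs] fps_mult_left_mono[OF fps_nonneg_two]
        geo_1_antimono) auto
  also have "\<dots> \<preceq> r * s * (geo 1 * geos [m, 12 * m, 12 * m])"
    using assms by (intro fps_mult_left_mono[OF rs] balance_lower_dilated)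
  also have "\<dots> = r * s * (geo 1 * (fps_X ^ 0 * geos [m, 12 * m, 12 * m]))" by simp
  also have "\<dots> \<preceq> r * s * (geo 1 * (fps_X ^ 0 * geos [m, b + 1, b + 2]))"
    using assms by (intro fps_mult_left_mono[OF rs] geo_1_antimono) auto
  also have "\<dots> = partition_gf a * partition_gf (b + 2)"
  proof -
    show ?thesis
      unfolding partition_gf_add_2 r(2) s(2) geos_simps
      by (simp only: ac_simps mult_1_left mult_1_right power_0)
  qed
  finally show ?thesis by (simp add: a_def)
qed

text \<open>
  Now \<open>b \<ge> 12m - 1\<close> is large enough for \<open>partition_gf (b - 2)\<close> to contain the parts
  \<open>1, 2m, 3m\<close>, while \<open>partition_gf (4m - 2)\<close> contains \<open>m, 2m\<close>; these supply the factor
  \<open>geo 1\<close> for rounding and the smoothing factor of \<open>balance_both\<close>. On the left \<open>b - 1\<close> and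
  \<open>b\<close> are rounded down to \<open>10m\<close>. As \<open>b\<close> is unbounded, the parts \<open>b - 1, \<dots>, b + 2\<close> of the
  lower neighbour cannot be rounded up and are dropped.
\<close>

lemma dominated_by_both:
  assumes "0 < m" "12 * m \<le> b + 1"
  shows "2 * (fps_X ^ (7 * m) * ((1 - fps_X ^ m) * (partition_gf (4 * m) * partition_gf b)))
    \<preceq> partition_gf (4 * m - 2) * partition_gf (b + 2)
      + fps_X ^ (16 * m + 4) * (partition_gf (4 * m + 2) * partition_gf (b - 2))"
proof -
  define a where "a = 4 * m - 2"
  define c where "c = b - 2"
  have a: "4 * m = Suc (Suc a)" using assms unfolding a_def by arith
  have pa: "partition_gf (4 * m) = partition_gf a * geos [Suc a, 4 * m]"
    using partition_gf_Suc[of a] partition_gf_Suc[of "Suc a"] a by (simp add: mult.assoc)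
  have b: "b = Suc (Suc c)" using assms by (simp add: c_def)
  have pb: "partition_gf b = partition_gf c * geos [Suc c, b]"
    using partition_gf_Suc[of c] partition_gf_Suc[of "Suc c"] b by (simp add: mult.assoc)
  obtain r where r: "0 \<preceq> r" "partition_gf a = r * geos [m, 2 * m]"
    by (rule partition_gf_factor[of "[m, 2 * m]" a]) (use assms in \<open>auto simp: a_def\<close>)
  obtain s where s: "0 \<preceq> s" "partition_gf c = s * geos [1, 2 * m, 3 * m]"
    by (rule partition_gf_factor[of "[1, 2 * m, 3 * m]" c]) (use assms in \<open>auto simp: c_def\<close>)
  have rs: "0 \<preceq> r * s" using r s by (intro fps_nonneg_mult)
  have sa: "Suc a \<le> 4 * m" using a by simp
  \<comment> \<open>Indeed \<open>b - 1 \<ge> 12 m - 2 \<ge> 10 m\<close>, with equality for \<open>m = 1\<close> and \<open>b = 11\<close>.\<close>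
  have ten: "10 * m \<le> Suc c" "10 * m \<le> b" using assms b by arith+
  define L where "L = geo 1 * geos [m, 2 * m, 2 * m, 3 * m]"
  define U where "U = geo 1 * (fps_X ^ (16 * m + 4) *
      geos [m, 2 * m, 2 * m, 3 * m, Suc a, 4 * m, 4 * m + 1, 4 * m + 2])"
  have "2 * (fps_X ^ (7 * m) * ((1 - fps_X ^ m) * (partition_gf (4 * m) * partition_gf b)))
      = r * s * (2 * (geo 1 * (fps_X ^ (7 * m) *
          ((1 - fps_X ^ m) * (geo m * geos [2 * m, 2 * m, 3 * m, Suc a, 4 * m, Suc c, b])))))"
    unfolding pa pb r(2) s(2) geos_simps
      by (simp only: ac_simps mult_1_left mult_1_right)
  also have "\<dots> = r * s * (2 * (geo 1 * (fps_X ^ (7 * m) *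
          geos [2 * m, 2 * m, 3 * m, Suc a, 4 * m, Suc c, b])))"
    unfolding cancel_geo[OF assms(1)] ..
  also have "\<dots> \<preceq> r * s * (2 * (geo 1 * (fps_X ^ (7 * m) *
          geos [2 * m, 2 * m, 3 * m, 3 * m, 4 * m, 10 * m, 10 * m])))"
    using assms a ten by (intro fps_mult_left_mono[OF rs] fps_mult_left_mono[OF fps_nonneg_two]
        geo_1_antimono) auto
  also have "\<dots> \<preceq> r * s * (L + geo 1 * (fps_X ^ (20 * m) *
          geos [m, 2 * m, 2 * m, 3 * m, 4 * m, 4 * m, 5 * m, 6 * m]))"
    unfolding L_def using assms by (intro fps_mult_left_mono[OF rs] balance_both_dilated)
  also have "\<dots> \<preceq> r * s * (L * geos [Suc c, b, b + 1, b + 2] + U)"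
  proof (intro fps_mult_left_mono[OF rs] fps_le_add)
    have "L * 1 \<preceq> L * geos [Suc c, b, b + 1, b + 2]"
      unfolding L_def by (intro fps_mult_left_mono fps_nonneg_mult one_le_geos geo_nonneg geos_nonneg)
    then show "L \<preceq> L * geos [Suc c, b, b + 1, b + 2]" by simp
    show "geo 1 * (fps_X ^ (20 * m) * geos [m, 2 * m, 2 * m, 3 * m, 4 * m, 4 * m, 5 * m, 6 * m]) \<preceq> U"
      unfolding U_def using assms sa by (intro geo_1_antimono) auto
  qed
  also have "\<dots> = partition_gf a * partition_gf (b + 2)
      + fps_X ^ (16 * m + 4) * (partition_gf (4 * m + 2) * partition_gf c)"
  proof -
    show ?thesis
      unfolding L_def U_def partition_gf_add_2 pa pb r(2) s(2) geos_simps
      by (simp only: algebra_simps mult_1_left mult_1_right)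
  qed
  finally show ?thesis by (simp add: a_def c_def)
qed

section \<open>The integer trace of a generalized Gaussian binomial\<close>

text \<open>
  Stated for an abstract \<open>q\<close> with inverses \<open>g i\<close> of \<open>1 - q\<^sup>i\<close>, because it is applied to a
  power \<open>q\<close> of the variable and a \<open>z\<close> that is not a power of \<open>q\<close>. The induction step is the
  \<open>q\<close>-Pascal rule \<open>(1 - q\<^bsup>a+b\<^esup>) W(a,b) = W(a,b-1) + q\<^sup>b W(a-1,b)\<close>, which comes from
  \<open>1 - q\<^bsup>a+b\<^esup> = (1 - q\<^sup>b) + q\<^sup>b (1 - q\<^sup>a)\<close>.
\<close>

lemma q_binomial:
  fixes q z :: "'a :: comm_ring_1" and g :: "nat \<Rightarrow> 'a"
  assumes inv: "\<And>i. 0 < i \<Longrightarrow> g i * (1 - q ^ i) = 1"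
  defines "P \<equiv> \<lambda>n. \<Prod>i=1..n. g i"
  shows "(\<Prod>i=1..k. 1 + z * q ^ i) * P k =
    (\<Sum>j\<le>k. z ^ j * q ^ (Suc j choose 2) * (P j * P (k - j)))"
proof (induction k)
  case 0
  show ?case by (simp add: P_def binomial_eq_0)
next
  case (Suc k)
  define S where "S k = (\<Sum>j\<le>k. z ^ j * q ^ (Suc j choose 2) * (P j * P (k - j)))" for k
  have P_Suc: "P (Suc n) = P n * g (Suc n)" for n
    by (simp add: P_def)
  have cancel: "(1 - q ^ Suc n) * P (Suc n) = P n" for n
  proof -
    have "(1 - q ^ Suc n) * P (Suc n) = P n * (g (Suc n) * (1 - q ^ Suc n))"
      unfolding P_Suc by (simp only: ac_simps)
    also have "g (Suc n) * (1 - q ^ Suc n) = 1" by (rule inv) simp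
    finally show ?thesis by simp
  qed
  have split: "(1 - q ^ Suc k) * (P j * P (Suc k - j)) =
      (1 - q ^ (Suc k - j)) * P (Suc k - j) * P j + q ^ (Suc k - j) * ((1 - q ^ j) * P j * P (Suc k - j))"
    if "j \<le> Suc k" for j
  proof -
    have "q ^ Suc k = q ^ (Suc k - j) * q ^ j" using that by (simp flip: power_add)
    then show ?thesis by (simp only: algebra_simps mult_1_left)
  qed
  have "(1 - q ^ Suc k) * S (Suc k) =
      (\<Sum>j\<le>Suc k. z ^ j * q ^ (Suc j choose 2) *
        ((1 - q ^ (Suc k - j)) * P (Suc k - j) * P j))
    + (\<Sum>j\<le>Suc k. z ^ j * q ^ (Suc j choose 2) *
        (q ^ (Suc k - j) * ((1 - q ^ j) * P j * P (Suc k - j))))"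
    unfolding S_def sum_distrib_left sum.distrib [symmetric]
  proof (rule sum.cong)
    fix j assume "j \<in> {..Suc k}"
    then have "j \<le> Suc k" by simp
    have "(1 - q ^ Suc k) * (z ^ j * q ^ (Suc j choose 2) * (P j * P (Suc k - j))) =
      z ^ j * q ^ (Suc j choose 2) * ((1 - q ^ Suc k) * (P j * P (Suc k - j)))"
      by (simp only: ac_simps)
    then show "(1 - q ^ Suc k) * (z ^ j * q ^ (Suc j choose 2) * (P j * P (Suc k - j))) =
      z ^ j * q ^ (Suc j choose 2) * ((1 - q ^ (Suc k - j)) * P (Suc k - j) * P j) +
      z ^ j * q ^ (Suc j choose 2) * (q ^ (Suc k - j) * ((1 - q ^ j) * P j * P (Suc k - j)))"
      unfolding split[OF \<open>j \<le> Suc k\<close>] distrib_left .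
  qed simp
  also have "(\<Sum>j\<le>Suc k. z ^ j * q ^ (Suc j choose 2) *
        ((1 - q ^ (Suc k - j)) * P (Suc k - j) * P j)) = S k"
  proof -
    have "(1 - q ^ (Suc k - j)) * P (Suc k - j) * P j = P j * P (k - j)" if "j \<le> k" for j
      using that cancel[of "k - j"] by (simp add: Suc_diff_le mult.commute)
    then show ?thesis by (simp add: S_def)
  qed
  also have "(\<Sum>j\<le>Suc k. z ^ j * q ^ (Suc j choose 2) *
        (q ^ (Suc k - j) * ((1 - q ^ j) * P j * P (Suc k - j))))
      = z * q ^ Suc k * S k"
  proof -
    have "z ^ Suc j * q ^ (Suc (Suc j) choose 2) *
        (q ^ (Suc k - Suc j) * ((1 - q ^ Suc j) * P (Suc j) * P (Suc k - Suc j)))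
        = z * q ^ Suc k * (z ^ j * q ^ (Suc j choose 2) * (P j * P (k - j)))" if "j \<le> k" for j
    proof -
      have "(Suc (Suc j) choose 2) + (k - j) = Suc k + (Suc j choose 2)"
        using that by (simp add: numeral_2_eq_2 One_nat_def)
      then have exponent: "q ^ (Suc (Suc j) choose 2) * q ^ (k - j) = q ^ Suc k * q ^ (Suc j choose 2)"
        by (metis power_add)
      have "z ^ Suc j * q ^ (Suc (Suc j) choose 2) * (q ^ (k - j) * (P j * P (k - j)))
          = z ^ Suc j * (q ^ (Suc (Suc j) choose 2) * q ^ (k - j)) * (P j * P (k - j))"
        by (simp only: ac_simps)
      also have "\<dots> = z * q ^ Suc k * (z ^ j * q ^ (Suc j choose 2) * (P j * P (k - j)))"
        unfolding exponent power_Suc[of z] by (simp only: ac_simps)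
      finally show ?thesis unfolding cancel diff_Suc_Suc .
    qed
    then show ?thesis
      unfolding sum.atMost_Suc_shift S_def sum_distrib_left by simp
  qed
  finally have rec: "(1 - q ^ Suc k) * S (Suc k) = (1 + z * q ^ Suc k) * S k"
    by (simp add: algebra_simps)
  have "(\<Prod>i=1..Suc k. 1 + z * q ^ i) * P (Suc k) =
      g (Suc k) * ((1 + z * q ^ Suc k) * ((\<Prod>i=1..k. 1 + z * q ^ i) * P k))"
    by (simp add: P_Suc ac_simps)
  also have "\<dots> = g (Suc k) * (1 - q ^ Suc k) * S (Suc k)"
    unfolding Suc.IH S_def [symmetric] rec [symmetric] by (simp only: ac_simps)
  also have "\<dots> = S (Suc k)" by (simp only: inv[of "Suc k"] zero_less_Suc mult_1)
  finally show ?case unfolding S_def .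
qed

lemma partition_gf_dilate: "0 < m \<Longrightarrow> dilate m (partition_gf n) = (\<Prod>i=1..n. geo (m * i))"
  by (induction n) (simp_all add: partition_gf_def dilate_mult dilate_geo)

lemma subst_root_prod:
  "1 \<le> b \<Longrightarrow> subst_root b (prod f A) = (\<Prod>i\<in>A. subst_root b (f i))"
  by (induction A rule: infinite_finite_induct) (simp_all add: subst_root_1 subst_root_mult)

lemma gauss_binomial_eq_subst_root:
  assumes b: "1 \<le> b"
  shows "gauss_binomial (of_nat s / of_nat b) k =
    subst_root b ((\<Prod>i=1..k. 1 - fps_X ^ (s + b * i)) * dilate b (partition_gf k))"
proof -
  let ?D = "\<Prod>i=1..k. 1 - fps_X ^ (b * i) :: rat fps"
  have den: "(\<Prod>i=1..k. 1 - qpow (of_nat i)) = subst_root b ?D"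
    using b by (simp add: subst_root_prod subst_root_diff subst_root_1 subst_root_X_power)
  have num: "(\<Prod>i=1..k. 1 - qpow (of_nat s / of_nat b + of_nat i)) =
      subst_root b (\<Prod>i=1..k. 1 - fps_X ^ (s + b * i))"
    using b by (simp add: subst_root_prod subst_root_diff subst_root_1 subst_root_X_power add_divide_distrib)
  have "dilate b (partition_gf k) * ?D = (\<Prod>i=1..k. geo (b * i) * (1 - fps_X ^ (b * i)))"
    using b by (simp add: partition_gf_dilate prod.distrib)
  also have "\<dots> = 1"
    using b by (intro prod.neutral ballI geo_inverse) simp
  finally have inv: "subst_root b ?D * subst_root b (dilate b (partition_gf k)) = 1"
    using b by (simp add: subst_root_1 mult.commute flip: subst_root_mult)
  have "gauss_binomial (of_nat s / of_nat b) k =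
      gauss_binomial (of_nat s / of_nat b) k * subst_root b ?D * subst_root b (dilate b (partition_gf k))"
    using inv by (simp add: mult.assoc)
  then show ?thesis
    using gauss_binomial_mult_denominator[of "of_nat s / of_nat b" k] b
    by (simp only: den num subst_root_mult)
qed

lemma integer_trace_subst_root:
  assumes "1 \<le> b"
  shows "fps_nth (integer_trace (subst_root b f)) d = fps_nth f (b * d)"
proof -
  have "(of_nat d :: rat) = of_nat (b * d) / of_nat b" using assms by simp
  then have "subst_root_coeff b f (of_nat d) = fps_nth f (b * d)"
    using subst_root_coeff_of_nat[OF assms] by metis
  then show ?thesis using assms by (simp add: integer_trace_def subst_root.rep_eq)
qed

text \<open>
  The term \<open>q\<^bsup>j(j+1)/2\<^esup> W(j, k - j)\<close> of the expansion. The value 0 for \<open>j > k\<close> lets sums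
  over \<open>j\<close> be extended to full blocks of four.
\<close>

definition summand :: "nat \<Rightarrow> nat \<Rightarrow> rat fps" where
  "summand k j =
    (if j \<le> k then fps_X ^ (Suc j choose 2) * (partition_gf j * partition_gf (k - j)) else 0)"

lemma nth_X_power_dilate:
  assumes "0 < b"
  shows "fps_nth (fps_X ^ n * dilate b f) (b * d) =
    (if b dvd n then fps_nth (fps_X ^ (n div b) * f) d else 0)"
proof (cases "b dvd n")
  case True
  then obtain e where "n = b * e" ..
  then show ?thesis
    using assms dilate_nth[OF assms, of "fps_X ^ e * f" "b * d"]
    by (simp add: dilate_mult dilate_X_power)
next
  case False
  then show ?thesis using assms
    by (auto simp: fps_X_power_mult_nth dilate_nth not_less dest: dvd_diffD1)
qed

text \<open>
  In the variable \<open>q\<^bsup>1/b\<^esup>\<close> the coefficients of the \<open>q\<close>-binomial expansion are series in the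
  \<open>b\<close>-th power of that variable. Hence the exponents of its \<open>j\<close>-th term are all integral or
  all nonintegral, depending on whether \<open>b\<close> divides \<open>s j\<close>.
\<close>

lemma integer_trace_gauss_binomial:
  assumes b: "1 \<le> b"
  shows "integer_trace (gauss_binomial (of_nat s / of_nat b) k) =
    (\<Sum>j\<le>k. if b dvd s * j then (- 1) ^ j * fps_X ^ (s * j div b) * summand k j else 0)"
proof (rule fps_ext)
  fix d
  have pos: "0 < b" using b by simp
  let ?q = "fps_X ^ b :: rat fps" and ?z = "- (fps_X ^ s) :: rat fps"
  have sign: "(- 1 :: rat fps) ^ j = fps_const ((- 1) ^ j)" for j
    by (induction j) simp_all
  have "(\<Prod>i=1..k. 1 - fps_X ^ (s + b * i)) * dilate b (partition_gf k) =
      (\<Prod>i=1..k. 1 + ?z * ?q ^ i) * (\<Prod>i=1..k. geo (b * i))"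
    using pos by (simp add: partition_gf_dilate power_add power_mult)
  also have "\<dots> = (\<Sum>j\<le>k. ?z ^ j * ?q ^ (Suc j choose 2) *
      ((\<Prod>i=1..j. geo (b * i)) * (\<Prod>i=1..k - j. geo (b * i))))"
  proof (rule q_binomial)
    show "geo (b * i) * (1 - ?q ^ i) = 1" if "0 < i" for i
      using geo_inverse[of "b * i"] pos that by (simp add: power_mult)
  qed
  also have "\<dots> = (\<Sum>j\<le>k. fps_const ((- 1) ^ j) * (fps_X ^ (s * j) * dilate b (summand k j)))"
  proof (intro sum.cong refl)
    fix j assume "j \<in> {..k}"
    have "?z ^ j = fps_const ((- 1) ^ j) * fps_X ^ (s * j)"
      unfolding sign power_minus[of "fps_X ^ s"] power_mult ..
    then show "?z ^ j * ?q ^ (Suc j choose 2) *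
        ((\<Prod>i=1..j. geo (b * i)) * (\<Prod>i=1..k - j. geo (b * i)))
        = fps_const ((- 1) ^ j) * (fps_X ^ (s * j) * dilate b (summand k j))"
      using \<open>j \<in> {..k}\<close> pos
      by (simp add: summand_def dilate_mult dilate_X_power partition_gf_dilate mult.assoc flip: power_mult)
  qed
  finally have "fps_nth (integer_trace (gauss_binomial (of_nat s / of_nat b) k)) d =
      (\<Sum>j\<le>k. (- 1) ^ j * fps_nth (fps_X ^ (s * j) * dilate b (summand k j)) (b * d))"
    using b by (simp add: gauss_binomial_eq_subst_root integer_trace_subst_root fps_sum_nth)
  also have "\<dots> = (\<Sum>j\<le>k. fps_nth
      (if b dvd s * j then (- 1) ^ j * fps_X ^ (s * j div b) * summand k j else 0) d)"
  proof (intro sum.cong refl)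
    fix j
    show "(- 1) ^ j * fps_nth (fps_X ^ (s * j) * dilate b (summand k j)) (b * d) =
      fps_nth (if b dvd s * j then (- 1) ^ j * fps_X ^ (s * j div b) * summand k j else 0) d"
      unfolding nth_X_power_dilate[OF pos] sign by (simp add: mult.assoc)
  qed
  finally show "fps_nth (integer_trace (gauss_binomial (of_nat s / of_nat b) k)) d =
     fps_nth (\<Sum>j\<le>k. if b dvd s * j then (- 1) ^ j * fps_X ^ (s * j div b) * summand k j else 0) d"
    by (simp add: fps_sum_nth)
qed

section \<open>Pairing the terms of the difference\<close>

text \<open>
  The three terms are divided by the monomial of the lower neighbour, and the lemmas above
  are applied with \<open>b = k - 4m\<close>. For \<open>b < 2\<close> the upper neighbour vanishes, so the small
  values of \<open>b\<close> must be covered by the lower one alone.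
\<close>

lemma dominated_by_neighbours:
  assumes "4 * Suc i \<le> k"
  shows "2 * ((fps_X ^ Suc i - fps_X ^ (2 * Suc i)) * summand k (4 * Suc i))
    \<preceq> fps_X ^ (2 * i + 1) * summand k (4 * i + 2)
      + fps_X ^ (2 * Suc i + 1) * summand k (4 * Suc i + 2)"
proof -
  define m where "m = Suc i"
  define b where "b = k - 4 * m"
  \<comment> \<open>The exponent of the lower neighbour, which is the lowest of the three.\<close>
  define e where "e = 8 * i ^ 2 + 12 * i + 4"
  have m: "0 < m" "4 * m - 2 = 4 * i + 2" by (simp_all add: m_def)
  have k: "k = 4 * m + b" using assms by (simp add: b_def m_def)
  have choose: "Suc (2 * n) choose 2 = n * (2 * n + 1)" for n
    by (simp add: choose_two algebra_simps)
  define A where "A = fps_X ^ (7 * m) * ((1 - fps_X ^ m) * (partition_gf (4 * m) * partition_gf b))"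
  have monomial: "fps_X ^ s * summand k j = fps_X ^ t * (partition_gf j * partition_gf (k - j))"
    if "s + (Suc j choose 2) = t" "j \<le> k" for s t j
    unfolding that(1) [symmetric] using that(2) by (simp add: summand_def power_add mult.assoc)
  have lower: "fps_X ^ (2 * i + 1) * summand k (4 * i + 2) =
      fps_X ^ e * (partition_gf (4 * m - 2) * partition_gf (b + 2))"
  proof -
    have "4 * i + 2 = 2 * (2 * i + 1)" by simp
    then have "Suc (4 * i + 2) choose 2 = (2 * i + 1) * (2 * (2 * i + 1) + 1)"
      by (simp only: choose)
    moreover have "2 * i + 1 + (2 * i + 1) * (2 * (2 * i + 1) + 1) = e"
      by (simp add: e_def algebra_simps power2_eq_square)
    ultimately have "2 * i + 1 + (Suc (4 * i + 2) choose 2) = e" by (simp only:)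
    moreover have "4 * i + 2 \<le> k" "k - (4 * i + 2) = b + 2" using k by (simp_all add: m_def)
    ultimately show ?thesis using monomial m(2) by metis
  qed
  have middle: "(fps_X ^ m - fps_X ^ (2 * m)) * summand k (4 * m) = fps_X ^ e * A"
  proof -
    have "4 * m = 2 * (2 * m)" by simp
    then have "Suc (4 * m) choose 2 = 2 * m * (2 * (2 * m) + 1)"
      by (simp only: choose)
    moreover have "m + 2 * m * (2 * (2 * m) + 1) = e + 7 * m"
      by (simp add: e_def m_def algebra_simps power2_eq_square)
    ultimately have "m + (Suc (4 * m) choose 2) = e + 7 * m" by (simp only:)
    then have "fps_X ^ m * fps_X ^ (Suc (4 * m) choose 2) = fps_X ^ e * (fps_X ^ (7 * m) :: rat fps)"
      by (metis power_add)
    moreover have "fps_X ^ m - fps_X ^ (2 * m) = (1 - fps_X ^ m) * (fps_X ^ m :: rat fps)"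
      by (simp add: mult_2 power_add left_diff_distrib)
    ultimately show ?thesis
      using k by (simp add: summand_def A_def ac_simps)
  qed
  have upper: "fps_X ^ (2 * m + 1) * summand k (4 * m + 2) =
      fps_X ^ e * (fps_X ^ (16 * m + 4) * (partition_gf (4 * m + 2) * partition_gf (b - 2)))"
    if "2 \<le> b"
  proof -
    have "4 * m + 2 = 2 * (2 * m + 1)" by simp
    then have "Suc (4 * m + 2) choose 2 = (2 * m + 1) * (2 * (2 * m + 1) + 1)"
      by (simp only: choose)
    moreover have "2 * m + 1 + (2 * m + 1) * (2 * (2 * m + 1) + 1) = e + (16 * m + 4)"
      by (simp add: e_def m_def algebra_simps power2_eq_square)
    ultimately have "2 * m + 1 + (Suc (4 * m + 2) choose 2) = e + (16 * m + 4)" by (simp only:)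
    moreover have "k - (4 * m + 2) = b - 2" "4 * m + 2 \<le> k" using k that by auto
    ultimately have "fps_X ^ (2 * m + 1) * summand k (4 * m + 2) =
        fps_X ^ (e + (16 * m + 4)) * (partition_gf (4 * m + 2) * partition_gf (b - 2))"
      using monomial by metis
    then show ?thesis by (simp only: power_add mult.assoc)
  qed
  have upper_nonneg: "0 \<preceq> fps_X ^ (2 * m + 1) * summand k (4 * m + 2)"
    by (auto simp: summand_def intro!: fps_nonneg_mult)
  consider "b = 0" | "0 < b" "b + 2 \<le> 12 * m" | "12 * m \<le> b + 1" by linarith
  then have "2 * A * fps_X ^ e \<preceq> fps_X ^ e * (partition_gf (4 * m - 2) * partition_gf (b + 2))
      + fps_X ^ (2 * m + 1) * summand k (4 * m + 2)"
  proof cases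
    assume "12 * m \<le> b + 1"
    then have "2 \<le> b" using m(1) by linarith
    have "fps_X ^ e * (2 * A) \<preceq> fps_X ^ e * (partition_gf (4 * m - 2) * partition_gf (b + 2)
      + fps_X ^ (16 * m + 4) * (partition_gf (4 * m + 2) * partition_gf (b - 2)))"
      unfolding A_def by (intro fps_mult_left_mono dominated_by_both m fps_nonneg_X_power) fact
    then show ?thesis
      unfolding upper[OF \<open>2 \<le> b\<close>] by (simp only: distrib_left ac_simps)
  next
    assume "b = 0"
    have "partition_gf 0 = 1" by (simp add: partition_gf_def)
    then have "2 * A \<preceq> partition_gf (4 * m - 2) * partition_gf (b + 2)"
      using dominated_by_lower_empty[OF m(1)] by (simp only: A_def \<open>b = 0\<close> add_0 mult_1_right)
    then have "fps_X ^ e * (2 * A) + 0 \<preceq> fps_X ^ e * (partition_gf (4 * m - 2) * partition_gf (b + 2))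
        + fps_X ^ (2 * m + 1) * summand k (4 * m + 2)"
      by (intro fps_le_add fps_mult_left_mono fps_nonneg_X_power upper_nonneg)
    then show ?thesis by (simp add: ac_simps)
  next
    assume "0 < b" "b + 2 \<le> 12 * m"
    then have "2 * A \<preceq> partition_gf (4 * m - 2) * partition_gf (b + 2)"
      unfolding A_def by (intro dominated_by_lower m)
    then have "fps_X ^ e * (2 * A) + 0 \<preceq> fps_X ^ e * (partition_gf (4 * m - 2) * partition_gf (b + 2))
        + fps_X ^ (2 * m + 1) * summand k (4 * m + 2)"
      by (intro fps_le_add fps_mult_left_mono fps_nonneg_X_power upper_nonneg)
    then show ?thesis by (simp add: ac_simps)
  qed
  then show ?thesis
    unfolding m_def [symmetric] lower middle by (simp add: ac_simps)
qed

text \<open>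
  Every \<open>E i\<close> is used for at most two negative terms, once as lower and once as upper
  neighbour, so half of it is available for each. In the induction the half of the last
  \<open>E n\<close> that has not yet been used is kept.
\<close>

lemma nonneg_sum_of_neighbours:
  assumes "N 0 = 0" "\<And>i. 0 \<preceq> E i" "\<And>i. i < n \<Longrightarrow> 2 * N (Suc i) \<preceq> E i + E (Suc i)"
  shows "0 \<preceq> (\<Sum>i\<le>n. E i - N i)"
proof -
  have "E n \<preceq> 2 * (\<Sum>i\<le>n. E i - N i)"
    using assms(3)
  proof (induction n)
    case 0
    have "0 \<preceq> E 0" by (rule assms(2))
    then show ?case using assms(1) by (simp add: fps_le_def numeral_fps_const)
  next
    case (Suc n)
    have "E n \<preceq> 2 * (\<Sum>i\<le>n. E i - N i)" "2 * N (Suc n) \<preceq> E n + E (Suc n)"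
      using Suc by auto
    then have "E n + 2 * N (Suc n) \<preceq> 2 * (\<Sum>i\<le>n. E i - N i) + (E n + E (Suc n))"
      by (rule fps_le_add)
    then show ?case
      by (simp add: fps_le_iff_diff[of "_ + _"] fps_le_iff_diff[of "E _"] algebra_simps)
  qed
  with assms(2)[of n] have "0 \<preceq> 2 * (\<Sum>i\<le>n. E i - N i)" by (rule fps_le_trans)
  then show ?thesis by (simp add: fps_le_def numeral_fps_const)
qed

lemma gauss_binomial_half_ge_quarter:
  "gauss_binomial (1/2) k \<ge>\<^sub>q gauss_binomial (1/4) k"
proof -
  define E where "E i = fps_X ^ (2 * i + 1) * summand k (4 * i + 2)" for i
  define N where "N i = (fps_X ^ i - fps_X ^ (2 * i)) * summand k (4 * i)" for i
  define h where "h j = (if even j then fps_X ^ (j div 2) * summand k j else 0)" for j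
  define h' where "h' j = (if 4 dvd j then fps_X ^ (j div 4) * summand k j else 0)" for j
  define n where "n = k div 4"
  have half: "integer_trace (gauss_binomial (1/2) k) = (\<Sum>j\<le>k. h j)"
    using integer_trace_gauss_binomial[of 2 1 k]
    by (auto simp: h_def intro!: sum.cong)
  have even: "even j" if "4 dvd j" for j :: nat
    using that by presburger
  have quarter: "integer_trace (gauss_binomial (1/4) k) = (\<Sum>j\<le>k. h' j)"
    using integer_trace_gauss_binomial[of 4 1 k]
    by (auto simp: h'_def even intro!: sum.cong)
  have "(\<Sum>j\<le>k. h j - h' j) = (\<Sum>j<Suc n * 4. h j - h' j)"
    by (rule sum.mono_neutral_left) (auto simp: n_def h_def h'_def summand_def)
  also have "\<dots> = (\<Sum>i\<le>n. \<Sum>j=i*4..<i*4+4. h j - h' j)"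
    by (simp only: sum.nat_group [symmetric] lessThan_Suc_atMost)
  also have "\<dots> = (\<Sum>i\<le>n. E i - N i)"
  proof (rule sum.cong)
    fix i :: nat
    have "{i*4..<i*4+4} = {4*i, 4*i+1, 4*i+2, 4*i+3}" by auto
    moreover have "\<not> 4 dvd 4*i+1" "\<not> 4 dvd 4*i+2" "\<not> 4 dvd 4*i+3" by presburger+
    ultimately show "(\<Sum>j=i*4..<i*4+4. h j - h' j) = E i - N i"
      by (simp add: h_def h'_def E_def N_def power_add algebra_simps)
  qed simp
  finally have eq: "(\<Sum>j\<le>k. h j) - (\<Sum>j\<le>k. h' j) = (\<Sum>i\<le>n. E i - N i)"
    by (simp add: sum_subtractf)
  have "0 \<preceq> (\<Sum>i\<le>n. E i - N i)"
  proof (rule nonneg_sum_of_neighbours)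
    show "N 0 = 0" by (simp add: N_def)
    show "0 \<preceq> E i" for i
      unfolding E_def summand_def by (auto intro!: fps_nonneg_mult)
    show "2 * N (Suc i) \<preceq> E i + E (Suc i)" if "i < n" for i
      unfolding N_def E_def by (rule dominated_by_neighbours) (use that in \<open>simp add: n_def\<close>)
  qed
  then show ?thesis
    unfolding eq [symmetric] half [symmetric] quarter [symmetric]
    by (simp add: puiseux_ge_def fps_le_def integer_trace_def minus_puiseux.rep_eq)
qed

theorem proposition6p2:
  fixes k :: nat
  assumes "1 \<le> k" and "k \<le> 150"
  shows "gauss_binomial (1/2) k \<ge>\<^sub>q gauss_binomial (1/4) k"
  by (rule gauss_binomial_half_ge_quarter)

end
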